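(* Let $f:\mathbb{R}^{p_1}\to\mathbb{R}$ be continuously differentiable, and let $\mathbf{B}\in\mathbb{R}^{p_1\times p_2}$ have full column rank. Consider the problem $$\underset{\mathbf{x}\in\mathbb{R}^{p_1},\ \mathbf{z}\in\mathbb{R}^{p_2}}{\text{minimize}}\ f(\mathbf{x})\quad\text{subject to}\quad \mathbf{x}+\mathbf{B}\mathbf{z}=\mathbf{0}. \qquad (P)$$ Suppose that at least one of the following two conditions holds: (a) $\nabla f$ is bounded, i.e. there exists $\kappa\in\mathbb{R}$ such that $\|\nabla f(\mathbf{x})\|\le\kappa$ for all $\mathbf{x}\in\mathbb{R}^{p_1}$; (b) $\|\mathbf{B}\|_\infty\le 1$ and $\|(\mathbf{B}^{T}\mathbf{B})^{-1}\mathbf{B}^{T}\|_\infty\le 1$, and there exists a scalar $c>0$ such that for every $i\in\{1,\dots,p_1\}$ and every $\mathbf{x}\in\mathbb{R}^{p_1}$: $[\nabla f(\mathbf{x})]_i<0$ whenever $\mathbf{x}_i<-c$, and $[\nabla f(\mathbf{x})]_i>0$ whenever $\mathbf{x}_i>c$. Let $\{(\mathbf{x}(t),\mathbf{z}(t))\}$ be generated by the Alternating Direction Penalty Method (ADPM) applied to $(P)$ with penalty parameters $\rho(t)>0$, $\lim_{t\to\infty}\rho(t)=\infty$, and multiplier vectors $\mathbf{y}(t)$, and let $r(t)=\|\mathbf{x}(t)+\mathbf{B}\mathbf{z}(t)\|$. Then: (i) If $\mathbf{y}(t)=\mathbf{0}$ for all $t\in\mathbb{N}$, then $\lim_{t\to\infty}r(t)=0$.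 (ii) If in addition (i.e. still with $\mathbf{y}(t)=\mathbf{0}$ for all $t$) $\sum_{t=0}^{\infty}1/\rho(t)=\infty$ and $\lim_{t\to\infty}(\mathbf{x}(t),\mathbf{z}(t))=(\mathbf{x}^\star,\mathbf{z}^\star)$, then $(\mathbf{x}^\star,\mathbf{z}^\star)$ satisfies the first order necessary (FON) conditions of problem $(P)$.
   Context: ADPM for $(P)$: the augmented Lagrangian is $$L_\rho(\mathbf{x},\mathbf{z},\mathbf{y})=f(\mathbf{x})+\mathbf{y}^{T}(\mathbf{x}+\mathbf{B}\mathbf{z})+\tfrac{\rho}{2}\|\mathbf{x}+\mathbf{B}\mathbf{z}\|^2 .$$ Starting from an arbitrary $\mathbf{z}(0)\in\mathbb{R}^{p_2}$, for $t=0,1,2,\dots$ the method computes $\mathbf{x}(t+1)\in\operatorname{argmin}_{\mathbf{x}\in\mathbb{R}^{p_1}}L_{\rho(t)}(\mathbf{x},\mathbf{z}(t),\mathbf{y}(t))$ and then $\mathbf{z}(t+1)\in\operatorname{argmin}_{\mathbf{z}\in\mathbb{R}^{p_2}}L_{\rho(t)}(\mathbf{x}(t+1),\mathbf{z},\mathbf{y}(t))$ (minimizers are assumed to exist at each step). The sequences $\rho(t)$ and $\mathbf{y}(t)$ are parameters chosen by the user. $\|\cdot\|$ is the Euclidean 2-norm, $\|\cdot\|_\infty$ on matrices is the norm induced by the vector sup-norm (maximum absolute row sum), and $\mathbf{x}_i$ is the $i$th component of $\mathbf{x}$. FON conditions of $(P)$ (there are no inequality constraints): $(\mathbf{x}^\star,\mathbf{z}^\star)$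 satisfies them if $\mathbf{x}^\star+\mathbf{B}\mathbf{z}^\star=\mathbf{0}$ and there is a Lagrange multiplier $\boldsymbol\lambda\in\mathbb{R}^{p_1}$ for which the gradient of the Lagrangian vanishes, i.e. $\nabla f(\mathbf{x}^\star)+\boldsymbol\lambda=\mathbf{0}$ and $\mathbf{B}^{T}\boldsymbol\lambda=\mathbf{0}$. *)

theory Defs
  imports "HOL-Analysis.Analysis"
begin

definition gradient :: "('a::real_inner \<Rightarrow> real) \<Rightarrow> 'a \<Rightarrow> 'a"
  where "gradient f x = (THE D. GDERIV f x :> D)"

lemma gradient_eqI:
  assumes "GDERIV f x :> D"
  shows "gradient f x = D"
  unfolding gradient_def
proof (rule the_equality)
  show "GDERIV f x :> D" by (fact assms)
  fix D' assume "GDERIV f x :> D'"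
  with assms have "(\<lambda>h. inner h D') = (\<lambda>h. inner h D)"
    unfolding gderiv_def by (rule has_derivative_unique[rotated])
  then have "inner (D' - D) (D' - D) = 0"
    by (metis inner_diff_right diff_self)
  then show "D' = D" by simp
qed

lemma GDERIV_gradient:
  fixes f :: "'a::euclidean_space \<Rightarrow> real"
  assumes "f differentiable (at x)"
  shows "GDERIV f x :> gradient f x"
proof -
  obtain f' where f': "(f has_derivative f') (at x)"
    using assms by (auto simp: differentiable_def)
  then have "linear f'" by (rule has_derivative_linear)
  then have "f' = (\<lambda>h. inner h (adjoint f' 1))"
    using adjoint_works[of f' _ 1] by (auto simp: fun_eq_iff)
  with f' have "GDERIV f x :> adjoint f' 1" by (simp add: gderiv_def)
  then show ?thesis using gradient_eqI by metis
qed

definition continuously_differentiable :: "('a::euclidean_space \<Rightarrow> real) \<Rightarrow> bool"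
  where "continuously_differentiable f \<longleftrightarrow>
    (\<forall>x. f differentiable (at x)) \<and> continuous_on UNIV (gradient f)"

text \<open>The operator norm induced by \<^const>\<open>infnorm\<close> on both sides, in the style of
  \<^const>\<open>onorm\<close>; the argument \<open>x = 0\<close> contributes \<open>0 / 0 = 0\<close>.\<close>

definition matrix_infnorm :: "real^'m^'n \<Rightarrow> real"
  where "matrix_infnorm A = (SUP x. infnorm (A *v x) / infnorm x)"

lemma infnorm_cart_le_iff:
  fixes x :: "real^'n"
  shows "infnorm x \<le> a \<longleftrightarrow> (\<forall>i. \<bar>x $ i\<bar> \<le> a)"
  by (auto simp: infnorm_Max Basis_vec_def inner_axis)

lemma matrix_infnorm_eq_max_row_sum:
  fixes A :: "real^'m^'n"
  shows "matrix_infnorm A = (MAX i. \<Sum>j\<in>UNIV. \<bar>A $ i $ j\<bar>)"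
proof -
  let ?s = "\<lambda>i. \<Sum>j\<in>UNIV. \<bar>A $ i $ j\<bar>"
  let ?M = "MAX i. ?s i"
  have row: "?s i \<le> ?M" for i by (rule Max_ge) auto
  have "?s undefined \<ge> 0" by (simp add: sum_nonneg)
  with row[of undefined] have M0: "?M \<ge> 0" by linarith
  have le: "infnorm (A *v x) / infnorm x \<le> ?M" for x
  proof (cases "x = 0")
    case True
    then show ?thesis using M0 by (simp add: infnorm_0)
  next
    case False
    have "\<bar>(A *v x) $ i\<bar> \<le> ?M * infnorm x" for i
    proof -
      have "\<bar>(A *v x) $ i\<bar> \<le> (\<Sum>j\<in>UNIV. \<bar>A $ i $ j * x $ j\<bar>)"
        unfolding matrix_vector_mult_def by simp
      also have "\<dots> \<le> (\<Sum>j\<in>UNIV. \<bar>A $ i $ j\<bar> * infnorm x)"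
        by (intro sum_mono) (simp add: abs_mult mult_left_mono component_le_infnorm_cart)
      also have "\<dots> = ?s i * infnorm x" by (simp add: sum_distrib_right)
      also have "\<dots> \<le> ?M * infnorm x"
        by (intro mult_right_mono row infnorm_pos_le)
      finally show ?thesis .
    qed
    then have "infnorm (A *v x) \<le> ?M * infnorm x" by (simp add: infnorm_cart_le_iff)
    then show ?thesis using False by (simp add: divide_le_eq infnorm_pos_lt)
  qed
  have "?M \<in> range ?s" by (intro Max_in) auto
  then obtain i where i: "?M = ?s i" by (rule rangeE)
  define x :: "real^'m" where "x = (\<chi> j. if A $ i $ j \<ge> 0 then 1 else - 1)"
  have x_abs: "\<bar>x $ j\<bar> = 1" for j by (simp add: x_def)
  have "infnorm x \<le> 1" by (simp add: infnorm_cart_le_iff x_abs)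
  moreover have "1 \<le> infnorm x" using component_le_infnorm_cart[of x] by (simp add: x_abs)
  ultimately have x1: "infnorm x = 1" by simp
  have "(A *v x) $ i = ?s i"
    unfolding matrix_vector_mult_def x_def by (auto intro!: sum.cong)
  then have "?M \<le> infnorm (A *v x) / infnorm x"
    using component_le_infnorm_cart[of "A *v x" i] i x1 by simp
  also have "\<dots> \<le> matrix_infnorm A"
    unfolding matrix_infnorm_def by (rule cSUP_upper) (auto intro!: bdd_aboveI[of _ ?M] le)
  finally have "?M \<le> matrix_infnorm A" .
  moreover have "matrix_infnorm A \<le> ?M"
    unfolding matrix_infnorm_def by (rule cSUP_least) (auto intro: le)
  ultimately show ?thesis by (rule antisym[rotated])
qed

definition augmented_lagrangian ::
  "(real^'p \<Rightarrow> real) \<Rightarrow> real^'q^'p \<Rightarrow> real \<Rightarrow> real^'p \<Rightarrow> real^'q \<Rightarrow> real^'p \<Rightarrow> real"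
  where "augmented_lagrangian f B \<rho> x z y =
    f x + y \<bullet> (x + B *v z) + \<rho> / 2 * (norm (x + B *v z))\<^sup>2"

text \<open>The starting point \<open>z 0\<close> is arbitrary. The method does not use \<open>x 0\<close>, which is therefore
  unconstrained as well.\<close>

definition adpm ::
  "(real^'p \<Rightarrow> real) \<Rightarrow> real^'q^'p \<Rightarrow> (nat \<Rightarrow> real) \<Rightarrow> (nat \<Rightarrow> real^'p) \<Rightarrow>
   (nat \<Rightarrow> real^'p) \<Rightarrow> (nat \<Rightarrow> real^'q) \<Rightarrow> bool"
  where "adpm f B \<rho> y x z \<longleftrightarrow>
    (\<forall>t. is_arg_min (\<lambda>u. augmented_lagrangian f B (\<rho> t) u (z t) (y t)) (\<lambda>_. True) (x (Suc t)) \<and>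
         is_arg_min (\<lambda>v. augmented_lagrangian f B (\<rho> t) (x (Suc t)) v (y t)) (\<lambda>_. True) (z (Suc t)))"

definition fon :: "(real^'p \<Rightarrow> real) \<Rightarrow> real^'q^'p \<Rightarrow> real^'p \<Rightarrow> real^'q \<Rightarrow> bool"
  where "fon f B x z \<longleftrightarrow>
    x + B *v z = 0 \<and> (\<exists>\<mu>. gradient f x + \<mu> = 0 \<and> transpose B *v \<mu> = 0)"

end

theory Submission
  imports Defs
begin

text \<open>With \<open>y = 0\<close>, optimality of \<open>x (t + 1)\<close> reads
  \<open>\<nabla>f (x (t + 1)) = - \<rho> t (x (t + 1) + B z t)\<close>, and the \<open>z\<close>-step can only decrease the residual,
  so \<open>r (t + 1) \<le> \<parallel>\<nabla>f (x (t + 1))\<parallel> / \<rho> t\<close>. Hence \<open>r\<close> vanishes in the limit as soon as the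
  gradient is bounded along the iterates. In case (b) the sign condition confines each
  coordinate of \<open>x (t + 1)\<close> to the larger of \<open>c\<close> and the size of \<open>(B z t)\<^sub>i\<close>, while the two matrix norm
  bounds make \<open>x \<mapsto> z\<close> and \<open>z \<mapsto> B z\<close> nonexpansive in the sup-norm; so the iterates stay in a
  compact box, on which the continuous gradient is bounded.

  For the second part, the two optimality conditions combine to
  \<open>B\<^sup>T B (z (t + 1) - z t) = B\<^sup>T \<nabla>f (x (t + 1)) / \<rho> t\<close>. As \<open>z\<close> converges while the sum of \<open>1 / \<rho> t\<close>
  diverges, the limit of \<open>B\<^sup>T \<nabla>f (x (t + 1))\<close> must be \<open>0\<close>.\<close>

section \<open>Sup-norm estimates and the Gram matrix\<close>

lemma infnorm_matrix_vector_mult_le: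
  fixes A :: "real^'m^'n"
  shows "infnorm (A *v v) \<le> matrix_infnorm A * infnorm v"
proof -
  have "\<bar>(A *v v) $ i\<bar> \<le> matrix_infnorm A * infnorm v" for i
  proof -
    have "\<bar>(A *v v) $ i\<bar> \<le> (\<Sum>j\<in>UNIV. \<bar>A $ i $ j * v $ j\<bar>)"
      unfolding matrix_vector_mult_def by simp
    also have "\<dots> \<le> (\<Sum>j\<in>UNIV. \<bar>A $ i $ j\<bar> * infnorm v)"
      by (intro sum_mono) (simp add: abs_mult mult_left_mono component_le_infnorm_cart)
    also have "\<dots> = (\<Sum>j\<in>UNIV. \<bar>A $ i $ j\<bar>) * infnorm v"
      by (simp add: sum_distrib_right)
    also have "\<dots> \<le> matrix_infnorm A * infnorm v"
      unfolding matrix_infnorm_eq_max_row_sum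
      by (intro mult_right_mono infnorm_pos_le Max_ge) auto
    finally show ?thesis .
  qed
  then show ?thesis by (simp add: infnorm_cart_le_iff)
qed

lemma infnorm_matrix_vector_mult_le_self:
  fixes A :: "real^'m^'n"
  assumes "matrix_infnorm A \<le> 1"
  shows "infnorm (A *v v) \<le> infnorm v"
  using infnorm_matrix_vector_mult_le[of A v] mult_right_mono[OF assms infnorm_pos_le[of v]]
  by simp

text \<open>The Gram matrix has trivial kernel: if it maps \<open>u\<close> to 0, pairing with
  \<open>u\<close> gives \<open>B *v u = 0\<close>, and full column rank makes \<open>B\<close>
  injective.\<close>

lemma matrix_inv_gram_left:
  fixes B :: "real^'q^'p"
  assumes "rank B = CARD('q)"
  shows "matrix_inv (transpose B ** B) ** (transpose B ** B) = mat 1"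
proof -
  have inj: "inj ((*v) B)" using assms by (simp add: full_rank_injective)
  have "u = 0" if "(transpose B ** B) *v u = 0" for u
  proof -
    have "(B *v u) \<bullet> (B *v u) = ((transpose B ** B) *v u) \<bullet> u"
      by (simp add: dot_lmul_matrix flip: matrix_vector_mul_assoc)
    with that have "B *v u = B *v 0" by simp
    with inj show ?thesis by (rule injD)
  qed
  then have "invertible (transpose B ** B)"
    by (simp add: invertible_left_inverse matrix_left_invertible_ker)
  then show ?thesis
    unfolding invertible_def matrix_inv_def by (rule someI2_ex) simp
qed

lemma is_arg_min_derivative_zero:
  fixes g :: "'a::real_normed_vector \<Rightarrow> real"
  assumes "is_arg_min g (\<lambda>_. True) a" and "(g has_derivative g') (at a)"
  shows "g' h = 0"
proof -
  have "g a \<le> g b" for b using assms(1) by (auto simp: is_arg_min_def not_less)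
  with assms(2) have "g' = (\<lambda>h. 0)" by (intro has_derivative_local_min) auto
  then show ?thesis by simp
qed

text \<open>If \<open>g\<close> were nonzero, the steps of \<open>u\<close> in direction
  \<open>g\<close> would eventually be at least a fixed positive multiple of \<open>d t\<close>, so
  \<open>u n \<bullet> g\<close> would diverge together with the partial sums of
  \<open>d\<close>.\<close>

lemma limit_zero_if_step_sum_diverges:
  fixes u v :: "nat \<Rightarrow> 'a::real_inner"
  assumes u: "u \<longlonglongrightarrow> l" and v: "v \<longlonglongrightarrow> g"
    and step: "\<And>t. u (Suc t) - u t = d t *\<^sub>R v t"
    and d: "\<And>t. d t \<ge> 0"
    and div: "filterlim (\<lambda>n. \<Sum>t<n. d t) at_top sequentially"
  shows "g = 0"
proof (rule ccontr)
  assume "g \<noteq> 0"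
  \<comment> \<open>Half of the limit of \<open>v t \<bullet> g\<close> leaves room for an eventual
    strict lower bound.\<close>
  define e where "e = (g \<bullet> g) / 2"
  have e: "e > 0" "e < g \<bullet> g" using \<open>g \<noteq> 0\<close> by (auto simp: e_def)
  have "(\<lambda>t. v t \<bullet> g) \<longlonglongrightarrow> g \<bullet> g" using v by (intro tendsto_intros)
  then have "eventually (\<lambda>t. v t \<bullet> g > e) sequentially" using e(2) by (rule order_tendstoD)
  then obtain N where N: "\<And>t. t \<ge> N \<Longrightarrow> v t \<bullet> g > e" by (auto simp: eventually_sequentially)
  define S where "S n = (\<Sum>t<n. d t)" for n
  \<comment> \<open>The constant is chosen to give equality at \<open>n = N\<close>; passing to
    \<open>Suc n\<close> adds \<open>e * d n\<close> on the left and
    \<open>d n * (v n \<bullet> g)\<close> on the right.\<close>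
  have lower: "(u N \<bullet> g - e * S N) + e * S n \<le> u n \<bullet> g" if "n \<ge> N" for n
    using that
  proof (induction n rule: dec_induct)
    case base
    show ?case by simp
  next
    case (step n)
    have "u (Suc n) \<bullet> g = u n \<bullet> g + d n * (v n \<bullet> g)"
      using assms(3)[of n] by (simp add: algebra_simps flip: inner_diff_left inner_scaleR_left)
    moreover have "d n * e \<le> d n * (v n \<bullet> g)"
      using N[OF step.hyps(1)] d by (intro mult_left_mono) auto
    ultimately show ?case using step.IH by (simp add: S_def algebra_simps)
  qed
  have "filterlim S at_top sequentially" using div by (simp add: S_def[abs_def])
  then have "filterlim (\<lambda>n. (u N \<bullet> g - e * S N) + e * S n) at_top sequentially"
    by (intro filterlim_tendsto_add_at_top[OF tendsto_const]
        filterlim_tendsto_pos_mult_at_top[OF tendsto_const e(1)])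
  then have "filterlim (\<lambda>n. u n \<bullet> g) at_top sequentially"
    by (rule filterlim_at_top_mono) (auto simp: eventually_sequentially intro!: exI[of _ N] lower)
  moreover have "(\<lambda>n. u n \<bullet> g) \<longlonglongrightarrow> l \<bullet> g" using u by (intro tendsto_intros)
  ultimately show False
    using not_tendsto_and_filterlim_at_infinity[OF sequentially_bot]
      filterlim_at_top_imp_at_infinity by blast
qed

section \<open>Optimality conditions of the two steps and decay of the residual\<close>

lemma adpm_x_stationary:
  assumes "continuously_differentiable f" and "adpm f B \<rho> y x z" and "y t = 0"
  shows "gradient f (x (Suc t)) = - \<rho> t *\<^sub>R (x (Suc t) + B *v z t)"
proof -
  let ?w = "x (Suc t) + B *v z t"
  have "(f has_derivative (\<lambda>h. h \<bullet> gradient f (x (Suc t)))) (at (x (Suc t)))"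
    using assms(1) GDERIV_gradient by (auto simp: continuously_differentiable_def gderiv_def)
  \<comment> \<open>Writing the squared norm as an inner product avoids differentiating the norm,
    which fails at the origin.\<close>
  then have "((\<lambda>u. augmented_lagrangian f B (\<rho> t) u (z t) (y t)) has_derivative
      (\<lambda>h. h \<bullet> gradient f (x (Suc t)) + \<rho> t / 2 * (2 * (h \<bullet> ?w)))) (at (x (Suc t)))"
    unfolding augmented_lagrangian_def assms(3) power2_norm_eq_inner
    by (auto intro!: derivative_eq_intros simp: inner_commute)
  with assms(2) have "h \<bullet> gradient f (x (Suc t)) + \<rho> t / 2 * (2 * (h \<bullet> ?w)) = 0" for h
    by (intro is_arg_min_derivative_zero[where g' = "\<lambda>h. h \<bullet> gradient f (x (Suc t)) + \<rho> t / 2 * (2 * (h \<bullet> ?w))"])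
       (auto simp: adpm_def)
  then have "h \<bullet> (gradient f (x (Suc t)) + \<rho> t *\<^sub>R ?w) = 0" for h
    by (simp add: inner_add_right algebra_simps)
  then have "gradient f (x (Suc t)) + \<rho> t *\<^sub>R ?w = 0"
    using inner_eq_zero_iff by blast
  then show ?thesis by (simp add: eq_neg_iff_add_eq_0)
qed

text \<open>The z-step is a least squares fit, so its residual is orthogonal to the range of
  \<open>B\<close>.\<close>

lemma adpm_z_stationary:
  assumes "adpm f B \<rho> y x z" and "y t = 0" and "\<rho> t > 0"
  shows "transpose B *v (x (Suc t) + B *v z (Suc t)) = 0"
proof -
  let ?w = "x (Suc t) + B *v z (Suc t)"
  have [derivative_intros]: "((\<lambda>v. B *v v) has_derivative (\<lambda>h. B *v h)) (at a)" for a
    by (intro bounded_linear_imp_has_derivative matrix_vector_mul_bounded_linear)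
  have "((\<lambda>v. augmented_lagrangian f B (\<rho> t) (x (Suc t)) v (y t)) has_derivative
      (\<lambda>h. \<rho> t * (?w \<bullet> (B *v h)))) (at (z (Suc t)))"
    unfolding augmented_lagrangian_def assms(2) power2_norm_eq_inner
    by (auto intro!: derivative_eq_intros simp: inner_commute)
  with assms(1) have "\<rho> t * (?w \<bullet> (B *v h)) = 0" for h
    by (intro is_arg_min_derivative_zero[where g' = "\<lambda>h. \<rho> t * (?w \<bullet> (B *v h))"])
       (auto simp: adpm_def)
  with assms(3) have "(transpose B *v ?w) \<bullet> h = 0" for h
    by (simp add: dot_lmul_matrix)
  then show ?thesis using inner_eq_zero_iff by blast
qed

lemma adpm_residual_le:
  assumes "continuously_differentiable f" and "adpm f B \<rho> y x z" and "y t = 0" and "\<rho> t > 0"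
  shows "norm (x (Suc t) + B *v z (Suc t)) \<le> norm (gradient f (x (Suc t))) / \<rho> t"
proof -
  have "augmented_lagrangian f B (\<rho> t) (x (Suc t)) (z (Suc t)) (y t)
      \<le> augmented_lagrangian f B (\<rho> t) (x (Suc t)) (z t) (y t)"
    using assms(2) by (auto simp: adpm_def is_arg_min_def not_less)
  \<comment> \<open>Both values share \<open>f (x (Suc t))\<close>, so only the penalty terms are
    compared.\<close>
  with assms(3,4) have "norm (x (Suc t) + B *v z (Suc t)) \<le> norm (x (Suc t) + B *v z t)"
    by (simp add: augmented_lagrangian_def)
  also have "\<dots> = norm (gradient f (x (Suc t))) / \<rho> t"
    using assms(4) by (simp add: adpm_x_stationary[where y = y and f = f, OF assms(1-3)])
  finally show ?thesis .
qed

text \<open>The gradient bound is asked for along the iterates only, so that both a global bound and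
  confinement to a box can supply it.\<close>

lemma adpm_residual_tendsto_zero:
  assumes "continuously_differentiable f" and "adpm f B \<rho> y x z" and "\<And>t. y t = 0"
    and "\<And>t. \<rho> t > 0" and "filterlim \<rho> at_top sequentially"
    and "\<And>t. norm (gradient f (x (Suc t))) \<le> \<kappa>"
  shows "(\<lambda>t. norm (x t + B *v z t)) \<longlonglongrightarrow> 0"
proof -
  have "norm (x (Suc t) + B *v z (Suc t)) \<le> \<kappa> / \<rho> t" for t
    using adpm_residual_le[OF assms(1-4)] divide_right_mono[OF assms(6) less_imp_le[OF assms(4)]]
    by (rule order_trans)
  moreover have "(\<lambda>t. \<kappa> / \<rho> t) \<longlonglongrightarrow> 0"
    using assms(5) by (rule tendsto_divide_0[OF tendsto_const filterlim_at_top_imp_at_infinity])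
  ultimately have "(\<lambda>t. norm (x (Suc t) + B *v z (Suc t))) \<longlonglongrightarrow> 0"
    by (auto intro: Lim_null_comparison[where g = "\<lambda>t. \<kappa> / \<rho> t", OF always_eventually])
  then show ?thesis by (rule LIMSEQ_imp_Suc)
qed

section \<open>Boundedness of the iterates in case (b)\<close>

lemma adpm_iterates_infnorm_le:
  fixes B :: "real^'q^'p"
  assumes f: "continuously_differentiable f" and rk: "rank B = CARD('q)"
    and adpm: "adpm f B \<rho> y x z" and y: "\<And>t. y t = 0" and \<rho>: "\<And>t. \<rho> t > 0"
    and B: "matrix_infnorm B \<le> 1"
    and P: "matrix_infnorm (matrix_inv (transpose B ** B) ** transpose B) \<le> 1"
    and lo: "\<And>i u. u $ i < - c \<Longrightarrow> gradient f u $ i < 0"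
    and hi: "\<And>i u. u $ i > c \<Longrightarrow> gradient f u $ i > 0"
  shows "infnorm (x (Suc t)) \<le> max c (infnorm (z 0))"
proof -
  have x_step: "infnorm (x (Suc t)) \<le> max c (infnorm (z t))" for t
  proof -
    have "\<bar>x (Suc t) $ i\<bar> \<le> max c (infnorm (z t))" for i
    proof -
      let ?a = "x (Suc t) $ i" and ?b = "(B *v z t) $ i"
      have grad: "gradient f (x (Suc t)) $ i = - \<rho> t * (?a + ?b)"
        by (simp add: adpm_x_stationary[OF f adpm y])
      \<comment> \<open>A coordinate outside the interval from \<open>- c\<close> to
        \<open>c\<close> has the sign of its partial derivative, hence the sign opposite to
        \<open>?a + ?b\<close>; this forces \<open>\<bar>?a\<bar> < \<bar>?b\<bar>\<close>.\<close>
      have "?a + ?b < 0" if "?a > c"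
        using hi[OF that] \<rho>[of t] unfolding grad by (simp add: mult_less_0_iff)
      moreover have "?a + ?b > 0" if "?a < - c"
        using lo[OF that] \<rho>[of t] unfolding grad by (simp add: zero_less_mult_iff)
      moreover have "\<bar>?b\<bar> \<le> infnorm (z t)"
        using component_le_infnorm_cart[of "B *v z t" i] infnorm_matrix_vector_mult_le_self[OF B, of "z t"]
        by linarith
      ultimately show ?thesis by linarith
    qed
    then show ?thesis by (simp add: infnorm_cart_le_iff)
  qed
  have z_step: "infnorm (z (Suc t)) \<le> infnorm (x (Suc t))" for t
  proof -
    let ?G = "transpose B ** B"
    \<comment> \<open>These are the normal equations; inverting the Gram matrix gives
      \<open>- z (Suc t)\<close> as the pseudoinverse of \<open>B\<close> applied to
      \<open>x (Suc t)\<close>.\<close>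
    have "transpose B *v x (Suc t) = - (?G *v z (Suc t))"
      using adpm_z_stationary[OF adpm y \<rho>, of t]
      by (simp add: matrix_vector_right_distrib matrix_vector_mul_assoc eq_neg_iff_add_eq_0)
    then have "(matrix_inv ?G ** transpose B) *v x (Suc t) = matrix_inv ?G *v (- (?G *v z (Suc t)))"
      by (simp flip: matrix_vector_mul_assoc)
    also have "\<dots> = - ((matrix_inv ?G ** ?G) *v z (Suc t))"
      by (simp only: matrix_vector_mul_assoc linear_neg[OF matrix_vector_mul_linear])
    finally have "(matrix_inv ?G ** transpose B) *v x (Suc t) = - z (Suc t)"
      by (simp add: matrix_inv_gram_left[OF rk])
    then show ?thesis
      using infnorm_matrix_vector_mult_le_self[OF P, of "x (Suc t)"] by (simp add: infnorm_neg)
  qed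
  have "infnorm (z t) \<le> max c (infnorm (z 0))" for t
  proof (induction t)
    case (Suc t)
    then show ?case using x_step[of t] z_step[of t] by linarith
  qed simp
  then show ?thesis using x_step[of t] by (meson max.boundedI max.cobounded1 order_trans)
qed

lemma continuous_gradient_bounded_on_infnorm_ball:
  fixes f :: "'a::euclidean_space \<Rightarrow> real"
  assumes "continuously_differentiable f"
  obtains \<kappa> where "\<And>u. infnorm u \<le> R \<Longrightarrow> norm (gradient f u) \<le> \<kappa>"
proof -
  \<comment> \<open>The Euclidean norm is at most \<open>sqrt DIM('a)\<close> times the sup-norm, so
    this compact ball contains the box.\<close>
  let ?K = "cball (0 :: 'a) (sqrt DIM('a) * R)"
  have "compact (gradient f ` ?K)"
    using assms by (intro compact_continuous_image compact_cball)
      (auto simp: continuously_differentiable_def intro: continuous_on_subset)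
  then obtain \<kappa> where \<kappa>: "\<And>u. u \<in> ?K \<Longrightarrow> norm (gradient f u) \<le> \<kappa>"
    using compact_imp_bounded bounded_iff by (metis imageI)
  have "norm (gradient f u) \<le> \<kappa>" if "infnorm u \<le> R" for u
    using norm_le_infnorm[of u] mult_left_mono[OF that real_sqrt_ge_zero[OF of_nat_0_le_iff], of "DIM('a)"]
    by (intro \<kappa>, unfold mem_cball_0) (rule order_trans)
  then show thesis by (rule that)
qed

text \<open>The multiplier is minus the gradient at the limit. Feasibility comes from the vanishing
  residual, and the divergent step sum yields
  \<open>transpose B *v gradient f xs = 0\<close>.\<close>

lemma adpm_limit_fon:
  assumes f: "continuously_differentiable f" and adpm: "adpm f B \<rho> y x z"
    and y: "\<And>t. y t = 0" and \<rho>: "\<And>t. \<rho> t > 0"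
    and residual: "(\<lambda>t. norm (x t + B *v z t)) \<longlonglongrightarrow> 0"
    and div: "filterlim (\<lambda>n. \<Sum>t<n. 1 / \<rho> t) at_top sequentially"
    and x: "x \<longlonglongrightarrow> xs" and z: "z \<longlonglongrightarrow> zs"
  shows "fon f B xs zs"
proof -
  note mat_lim = bounded_linear.tendsto[OF matrix_vector_mul_bounded_linear]
  have "(\<lambda>t. x t + B *v z t) \<longlonglongrightarrow> xs + B *v zs"
    by (intro tendsto_add x mat_lim z)
  moreover have "(\<lambda>t. x t + B *v z t) \<longlonglongrightarrow> 0"
    using residual by (rule tendsto_norm_zero_cancel)
  ultimately have feasible: "xs + B *v zs = 0" by (rule LIMSEQ_unique)
  have "isCont (gradient f) xs"
    using f by (simp add: continuously_differentiable_def continuous_on_eq_continuous_at)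
  then have grad: "(\<lambda>t. gradient f (x (Suc t))) \<longlonglongrightarrow> gradient f xs"
    using LIMSEQ_Suc[OF x] by (rule isCont_tendsto_compose)
  \<comment> \<open>Orthogonality of the new residual to the range of \<open>B\<close> eliminates
    \<open>x (Suc t)\<close>, leaving increments of a convergent sequence with weights
    \<open>1 / \<rho> t\<close>.\<close>
  have step: "transpose B *v (B *v z (Suc t)) - transpose B *v (B *v z t)
      = (1 / \<rho> t) *\<^sub>R (transpose B *v gradient f (x (Suc t)))" for t
  proof -
    have "transpose B *v x (Suc t) = - (transpose B *v (B *v z (Suc t)))"
      using adpm_z_stationary[OF adpm y \<rho>, of t]
      by (simp add: matrix_vector_right_distrib eq_neg_iff_add_eq_0)
    moreover have "transpose B *v gradient f (x (Suc t))
        = - \<rho> t *\<^sub>R (transpose B *v x (Suc t) + transpose B *v (B *v z t))"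
      by (simp only: adpm_x_stationary[OF f adpm y] matrix_vector_right_distrib
          linear_scale[OF matrix_vector_mul_linear])
    ultimately show ?thesis using \<rho>[of t] by simp
  qed
  have "transpose B *v gradient f xs = 0"
    by (rule limit_zero_if_step_sum_diverges[OF mat_lim[OF mat_lim[OF z]] mat_lim[OF grad] step _ div])
       (simp add: \<rho> less_imp_le)
  then have "transpose B *v (- gradient f xs) = 0"
    by (simp add: linear_neg[OF matrix_vector_mul_linear])
  with feasible show ?thesis
    by (auto simp: fon_def intro!: exI[of _ "- gradient f xs"])
qed

theorem proposition1:
  fixes f :: "real^'p \<Rightarrow> real"
    and B :: "real^'q^'p"
    and \<rho> :: "nat \<Rightarrow> real"
    and x y :: "nat \<Rightarrow> real^'p"
    and z :: "nat \<Rightarrow> real^'q"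
  assumes "continuously_differentiable f"
    and "rank B = CARD('q)"
    and "(\<exists>\<kappa>. \<forall>u. norm (gradient f u) \<le> \<kappa>) \<or>
         (matrix_infnorm B \<le> 1 \<and>
          matrix_infnorm (matrix_inv (transpose B ** B) ** transpose B) \<le> 1 \<and>
          (\<exists>c>0. \<forall>i u. (u $ i < - c \<longrightarrow> gradient f u $ i < 0) \<and>
                       (u $ i > c \<longrightarrow> gradient f u $ i > 0)))"
    and "\<And>t. \<rho> t > 0"
    and "filterlim \<rho> at_top sequentially"
    and "adpm f B \<rho> y x z"
  shows "((\<forall>t. y t = 0) \<longrightarrow> (\<lambda>t. norm (x t + B *v z t)) \<longlonglongrightarrow> 0) \<and>
         (\<forall>xs zs. (\<forall>t. y t = 0) \<and>
                  filterlim (\<lambda>n. \<Sum>t<n. 1 / \<rho> t) at_top sequentially \<and>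
                  (\<lambda>t. (x t, z t)) \<longlonglongrightarrow> (xs, zs) \<longrightarrow>
                  fon f B xs zs)"
proof -
  \<comment> \<open>Stated separately because the second claim takes feasibility of the limit from
    it.\<close>
  have residual: "(\<lambda>t. norm (x t + B *v z t)) \<longlonglongrightarrow> 0" if y: "\<forall>t. y t = 0"
  proof -
    have y: "y t = 0" for t using that by simp
    obtain \<kappa> where "norm (gradient f (x (Suc t))) \<le> \<kappa>" for t
      using assms(3)
    proof (elim disjE exE conjE)
      fix \<kappa> assume "\<forall>u. norm (gradient f u) \<le> \<kappa>"
      then show thesis using that by blast
    next
      fix c :: real
      assume B: "matrix_infnorm B \<le> 1"
        "matrix_infnorm (matrix_inv (transpose B ** B) ** transpose B) \<le> 1"
        and c: "\<forall>i u. (u $ i < - c \<longrightarrow> gradient f u $ i < 0) \<and> (u $ i > c \<longrightarrow> gradient f u $ i > 0)"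
      obtain \<kappa> where "\<And>u. infnorm u \<le> max c (infnorm (z 0)) \<Longrightarrow> norm (gradient f u) \<le> \<kappa>"
        using continuous_gradient_bounded_on_infnorm_ball[OF assms(1)] by blast
      moreover have "infnorm (x (Suc t)) \<le> max c (infnorm (z 0))" for t
        using adpm_iterates_infnorm_le[OF assms(1,2,6) y assms(4) B] c by blast
      ultimately show thesis using that by blast
    qed
    then show ?thesis by (rule adpm_residual_tendsto_zero[OF assms(1,6) y assms(4,5)])
  qed
  moreover have "fon f B xs zs"
    if "\<forall>t. y t = 0" "filterlim (\<lambda>n. \<Sum>t<n. 1 / \<rho> t) at_top sequentially"
      "(\<lambda>t. (x t, z t)) \<longlonglongrightarrow> (xs, zs)" for xs zs
    using adpm_limit_fon[OF assms(1,6) _ assms(4) residual[OF that(1)] that(2)]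
      tendsto_fst[OF that(3)] tendsto_snd[OF that(3)] that(1) by simp
  ultimately show ?thesis by blast
qed

end
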